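(* $\bigcup_{g\in G}\mathcal{Z}_g=\mathcal{Z}_l$ and $\bigcap_{g\in G}\mathcal{Z}_g=\mathrm{Fin}$.
   Context: $\omega=\{0,1,2,\ldots\}$ and $n\in\omega$ is identified with $\{0,\ldots,n-1\}$. $G$ is the set of all functions $g\colon\omega\to(0,\infty)$ such that $g(n)\to\infty$ and $\frac{n}{g(n)}\not\to 0$ as $n\to\infty$. For $g\in G$, $\mathcal{Z}_g=\{A\subseteq\omega:\ \lim_{n\to\infty}\frac{\mathrm{card}(A\cap n)}{g(n)}=0\}$. $\mathcal{Z}_l=\{A\subseteq\omega:\ \liminf_{n\to\infty}\frac{\mathrm{card}(A\cap n)}{n}=0\}$ is the family of sets of lower asymptotic density zero, and $\mathrm{Fin}$ is the family of all finite subsets of $\omega$. *)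

theory Defs
  imports "HOL-Library.Extended_Real"
begin

definition G :: "(nat \<Rightarrow> real) set" where
  "G = {g. (\<forall>n. 0 < g n) \<and> filterlim g at_top sequentially \<and>
           \<not> (\<lambda>n. real n / g n) \<longlonglongrightarrow> 0}"

definition Z :: "(nat \<Rightarrow> real) \<Rightarrow> nat set set" where
  "Z g = {A. (\<lambda>n. real (card (A \<inter> {..<n})) / g n) \<longlonglongrightarrow> 0}"

(* liminf needs a complete lattice, hence the embedding into ereal;
   the term at n = 0 is 0 / 0 = 0 and does not affect the liminf *)
definition Z_l :: "nat set set" where
  "Z_l = {A. liminf (\<lambda>n. ereal (real (card (A \<inter> {..<n})) / real n)) = 0}"

definition Fin :: "nat set set" where
  "Fin = {A. finite A}"

end

theory Submission
  imports Defs "HOL-Analysis.Extended_Real_Limits"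
begin

text \<open>
  The members of \<open>G\<close> need not be monotone. For \<open>A\<close> of lower density zero, pick a sequence
  along which the density of \<open>A\<close> tends to 0; let \<open>g n = n + 1\<close> on this sequence and
  \<open>g n = (n + 1)\<^sup>2\<close> elsewhere. For infinite \<open>A\<close>, the function \<open>g n = card (A \<inter> n) + 1\<close>
  is in \<open>G\<close> but \<open>A\<close> is not in \<open>Z g\<close>.
\<close>

lemma card_Int_lessThan_le: "card (A \<inter> {..<n}) \<le> n" for n :: nat
  using card_mono[of "{..<n}" "A \<inter> {..<n}"] by simp

text \<open>The density \<open>c n / n\<close> is the quotient of \<open>c n / g n\<close> by
  \<open>n / g n\<close>. The former tends to 0, and the latter stays above a fixed \<epsilon> for
  infinitely many \<open>n\<close>, so the density gets arbitrarily small along those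
  \<open>n\<close>.\<close>

lemma Z_subset_Z_l:
  assumes "g \<in> G"
  shows "Z g \<subseteq> Z_l"
proof
  fix A assume "A \<in> Z g"
  define c where "c n = real (card (A \<inter> {..<n}))" for n
  define X where "X n = ereal (c n / real n)" for n
  have lim: "(\<lambda>n. c n / g n) \<longlonglongrightarrow> 0"
    using \<open>A \<in> Z g\<close> by (simp add: Z_def c_def)
  have pos: "0 < g n" for n
    using assms by (simp add: G_def)
  have "\<not> (\<lambda>n. real n / g n) \<longlonglongrightarrow> 0"
    using assms by (simp add: G_def)
  then obtain \<epsilon> where "\<epsilon> > 0" and often: "\<And>N. \<exists>n\<ge>N. \<epsilon> \<le> real n / g n"
    using pos by (auto simp: LIMSEQ_iff not_less less_imp_le abs_of_pos)
  have "liminf X \<le> ereal \<delta>" if "\<delta> > 0" for \<delta>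
  proof (rule ccontr)
    assume "\<not> liminf X \<le> ereal \<delta>"
    then have "eventually (\<lambda>n. ereal \<delta> < X n) sequentially"
      using less_LiminfD not_le by blast
    moreover have "eventually (\<lambda>n. c n / g n < \<delta> * \<epsilon>) sequentially"
      using lim that \<open>\<epsilon> > 0\<close> by (intro order_tendstoD(2)) auto
    ultimately obtain N where N: "\<And>n. n \<ge> N \<Longrightarrow> ereal \<delta> < X n \<and> c n / g n < \<delta> * \<epsilon>"
      unfolding eventually_sequentially by (meson le_trans nat_le_linear)
    obtain n where n: "n \<ge> N" "\<epsilon> \<le> real n / g n"
      using often by blast
    \<comment> \<open>At 0 the quotient \<open>n / g n\<close> vanishes, so it cannot reach
      \<epsilon>. Positivity is needed to clear the denominator \<open>n\<close> in
      \<open>X n\<close>.\<close>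
    have "n > 0"
      using n \<open>\<epsilon> > 0\<close> by (cases n) auto
    have "\<delta> * \<epsilon> \<le> \<delta> * (real n / g n)"
      using n that by (intro mult_left_mono) auto
    also have "\<dots> \<le> c n / g n"
      using N[OF n(1)] \<open>n > 0\<close> pos[of n] by (simp add: X_def field_simps)
    finally show False
      using N[OF n(1)] by simp
  qed
  then have "liminf X \<le> 0"
    using ereal_le_epsilon2[of "liminf X" 0] by simp
  moreover have "0 \<le> liminf X"
    by (intro Liminf_bounded) (auto simp: X_def c_def)
  ultimately show "A \<in> Z_l"
    by (simp add: Z_l_def X_def[abs_def] c_def)
qed

lemma Z_l_imp_Z:
  assumes "A \<in> Z_l"
  obtains g where "g \<in> G" "A \<in> Z g"
proof -
  define c where "c n = real (card (A \<inter> {..<n}))" for n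
  have c_le: "c n \<le> real n" for n
    by (simp add: c_def card_Int_lessThan_le)
  have c_nonneg: "0 \<le> c n" for n
    by (simp add: c_def)
  \<comment> \<open>Some subsequence realises the liminf as a genuine limit; as this limit is 0, it
    can be read in the reals.\<close>
  obtain r where r: "strict_mono r" and
    "((\<lambda>n. ereal (c n / real n)) \<circ> r) \<longlonglongrightarrow> liminf (\<lambda>n. ereal (c n / real n))"
    using liminf_subseq_lim by blast
  then have "(\<lambda>k. ereal (c (r k) / real (r k))) \<longlonglongrightarrow> ereal 0"
    using assms by (simp add: Z_l_def c_def o_def zero_ereal_def)
  then have lim: "(\<lambda>k. c (r k) / real (r k)) \<longlonglongrightarrow> 0"
    by simp
  \<comment> \<open>On the range of \<open>r\<close>, \<open>n / g n\<close> tends to 1, which keeps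
    \<open>g\<close> in \<open>G\<close>. Elsewhere \<open>c n \<le> n\<close> makes
    \<open>c n / g n\<close> at most \<open>1 / (n + 1)\<close>, whatever \<open>A\<close> is. The
    successor keeps \<open>g 0\<close> positive.\<close>
  define g :: "nat \<Rightarrow> real"
    where "g n = (if n \<in> range r then real (Suc n) else (real (Suc n))\<^sup>2)" for n
  have g_ge: "real (Suc n) \<le> g n" for n
    by (simp add: g_def power2_eq_square)
  have g_pos: "0 < g n" for n
    using g_ge[of n] by linarith
  have "filterlim g at_top sequentially"
  proof (rule filterlim_at_top_mono[OF filterlim_real_sequentially])
    show "eventually (\<lambda>n. real n \<le> g n) sequentially"
      by (intro always_eventually allI order_trans[OF _ g_ge]) simp
  qed
  moreover have "\<not> (\<lambda>n. real n / g n) \<longlonglongrightarrow> 0"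
  proof
    assume "(\<lambda>n. real n / g n) \<longlonglongrightarrow> 0"
    from LIMSEQ_subseq_LIMSEQ[OF this r]
    have "(\<lambda>k. real (r k) / real (Suc (r k))) \<longlonglongrightarrow> 0"
      by (simp add: o_def g_def)
    moreover have "(\<lambda>k. real (r k) / real (Suc (r k))) \<longlonglongrightarrow> 1"
      using LIMSEQ_subseq_LIMSEQ[OF LIMSEQ_n_over_Suc_n r] by (simp add: o_def)
    ultimately show False
      using LIMSEQ_unique zero_neq_one by blast
  qed
  ultimately have "g \<in> G"
    using g_pos by (simp add: G_def)
  moreover have "(\<lambda>n. c n / g n) \<longlonglongrightarrow> 0"
  proof (rule LIMSEQ_I)
    fix \<epsilon> :: real assume "\<epsilon> > 0"
    obtain K where K: "\<And>k. k \<ge> K \<Longrightarrow> c (r k) / real (r k) < \<epsilon>"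
      using order_tendstoD(2)[OF lim \<open>\<epsilon> > 0\<close>] by (auto simp: eventually_sequentially)
    obtain M where M: "\<And>n. n \<ge> M \<Longrightarrow> 1 / real (Suc n) < \<epsilon>"
      using order_tendstoD(2)[OF LIMSEQ_Suc[OF lim_1_over_n] \<open>\<epsilon> > 0\<close>]
      by (auto simp: eventually_sequentially)
    \<comment> \<open>The bound \<open>r K\<close> turns \<open>n = r k\<close> into
      \<open>K \<le> k\<close> by strict monotonicity, \<open>M\<close> serves the indices off the
      range, and \<open>Suc\<close> excludes \<open>n = 0\<close>, where comparing with
      \<open>c n / n\<close> would fail.\<close>
    have "c n / g n < \<epsilon>" if n: "n \<ge> Suc (max (r K) M)" for n
    proof (cases "n \<in> range r")
      case True
      then obtain k where k: "n = r k" by blast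
      have "r K \<le> r k"
        using n k by simp
      then have "K \<le> k"
        using r strict_mono_less_eq by blast
      have "c n / g n \<le> c n / real n"
        using True n c_nonneg by (intro divide_left_mono) (auto simp: g_def)
      also have "\<dots> < \<epsilon>"
        using K[OF \<open>K \<le> k\<close>] k by simp
      finally show ?thesis .
    next
      case False
      have "c n / g n \<le> real (Suc n) / g n"
        using c_le[of n] g_pos[of n] by (intro divide_right_mono) auto
      also have "\<dots> = 1 / real (Suc n)"
        using False by (simp add: g_def power2_eq_square)
      also have "\<dots> < \<epsilon>"
        using M n by simp
      finally show ?thesis .
    qed
    moreover have "norm (c n / g n - 0) = c n / g n" for n
      using c_nonneg[of n] g_pos[of n] by simp
    ultimately show "\<exists>N. \<forall>n\<ge>N. norm (c n / g n - 0) < \<epsilon>"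
      by metis
  qed
  then have "A \<in> Z g"
    by (simp add: Z_def c_def)
  ultimately show thesis
    using that by blast
qed

lemma finite_imp_Z:
  assumes "finite A" "g \<in> G"
  shows "A \<in> Z g"
proof -
  have pos: "0 < g n" for n
    using assms by (simp add: G_def)
  have lim: "filterlim g at_top sequentially"
    using assms by (simp add: G_def)
  have upper: "(\<lambda>n. real (card A) / g n) \<longlonglongrightarrow> 0"
    by (intro tendsto_divide_0[OF tendsto_const] filterlim_at_top_imp_at_infinity lim)
  have le: "real (card (A \<inter> {..<n})) / g n \<le> real (card A) / g n" for n
    using pos[of n] assms(1) by (intro divide_right_mono) (auto intro: card_mono)
  have "(\<lambda>n. real (card (A \<inter> {..<n})) / g n) \<longlonglongrightarrow> 0"
    by (rule tendsto_sandwich[OF _ _ tendsto_const upper]) (use pos le in \<open>simp_all add: less_imp_le\<close>)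
  then show ?thesis
    by (simp add: Z_def)
qed

text \<open>An infinite set has finite subsets of every size \<open>k\<close>, and each lies below
  some \<open>N\<close>, from which point on the count is at least \<open>k\<close>.\<close>

lemma filterlim_card_Int_lessThan:
  fixes A :: "nat set"
  assumes "infinite A"
  shows "filterlim (\<lambda>n. card (A \<inter> {..<n})) at_top sequentially"
  unfolding filterlim_at_top eventually_sequentially
proof
  fix k
  obtain B where B: "B \<subseteq> A" "finite B" "card B = k"
    using infinite_arbitrarily_large[OF assms] by blast
  then obtain N where "B \<subseteq> {..<N}"
    using finite_nat_iff_bounded by blast
  then have "k \<le> card (A \<inter> {..<n})" if "n \<ge> N" for n
    using that B by (auto intro!: card_mono)
  then show "\<exists>N. \<forall>n\<ge>N. k \<le> card (A \<inter> {..<n})"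
    by blast
qed

lemma infinite_imp_not_Z:
  assumes "infinite A"
  obtains g where "g \<in> G" "A \<notin> Z g"
proof -
  define c where "c n = card (A \<inter> {..<n})" for n
  \<comment> \<open>The successor keeps \<open>g\<close> positive before the first element of
    \<open>A\<close>.\<close>
  define g where "g n = real (Suc (c n))" for n
  have lim: "filterlim c at_top sequentially"
    unfolding c_def by (rule filterlim_card_Int_lessThan[OF assms])
  have "filterlim g at_top sequentially"
    unfolding g_def
    by (intro filterlim_compose[OF filterlim_real_sequentially]
              filterlim_compose[OF filterlim_Suc] lim)
  moreover have "\<not> (\<lambda>n. real n / g n) \<longlonglongrightarrow> 0"
  proof
    assume "(\<lambda>n. real n / g n) \<longlonglongrightarrow> 0"
    \<comment> \<open>Since \<open>c n \<le> n\<close>, \<open>g\<close> grows at most linearly, and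
      the lower bound tends to 1.\<close>
    moreover have "real n / real (Suc n) \<le> real n / g n" for n
      using card_Int_lessThan_le[of A n] by (intro divide_left_mono) (auto simp: g_def c_def)
    ultimately have "(1::real) \<le> 0"
      by (intro LIMSEQ_le[OF LIMSEQ_n_over_Suc_n]) auto
    then show False by simp
  qed
  ultimately have "g \<in> G"
    by (simp add: G_def g_def)
  \<comment> \<open>This is \<open>m / (m + 1)\<close> evaluated at \<open>m = c n\<close>, which
    tends to infinity.\<close>
  moreover have "(\<lambda>n. real (c n) / g n) \<longlonglongrightarrow> 1"
    using filterlim_compose[OF LIMSEQ_n_over_Suc_n lim] by (simp add: g_def)
  then have "A \<notin> Z g"
    by (auto simp: Z_def c_def dest: LIMSEQ_unique)
  ultimately show thesis
    using that by blast
qed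

theorem proposition2:
  shows "(\<Union>g\<in>G. Z g) = Z_l \<and> (\<Inter>g\<in>G. Z g) = Fin"
proof
  show "(\<Union>g\<in>G. Z g) = Z_l"
    using Z_subset_Z_l Z_l_imp_Z by blast
  show "(\<Inter>g\<in>G. Z g) = Fin"
    unfolding Fin_def using finite_imp_Z infinite_imp_not_Z by blast
qed

end
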